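(* Let $G$ be a graph, let $p \in \mathbb{N}$ and $N \in \mathbb{N}$. Suppose $P_{DP}(K_p \vee G, m) = P(K_p \vee G, m)$ for every integer $m \geq N$. Then $P_{DP}(K_{p+1} \vee G, s) = P(K_{p+1} \vee G, s)$ for every integer $s \geq N+1$. Consequently, $\tau_{DP}(K_{p+1} \vee G) \leq \tau_{DP}(K_p \vee G) + 1$.
   Context: All graphs are finite and simple. $G \vee H$ denotes the join of vertex-disjoint graphs $G$ and $H$. A cover of a graph $G$ is a pair $\mathcal{H}=(L,H)$ where $H$ is a graph and $L: V(G) \to \mathcal{P}(V(H))$ satisfies: (1) $\{L(u): u \in V(G)\}$ is a partition of $V(H)$ into $|V(G)|$ parts; (2) $H[L(u)]$ is complete for each $u$; (3) if there is an edge of $H$ between $L(u)$ and $L(v)$ with $u \neq v$, then $uv \in E(G)$; (4) if $uv \in E(G)$, the edges of $H$ between $L(u)$ and $L(v)$ form a (possibly empty) matching. The cover is $m$-fold if $|L(u)|=m$ for all $u$. An $\mathcal{H}$-coloring of $G$ is an independent set of $H$ of size $|V(G)|$. $P_{DP}(G,\mathcal{H})$ is the number of $\mathcal{H}$-colorings, and the DP color function $P_{DP}(G,m)$ is the minimum of $P_{DP}(G,\mathcal{H})$ over all $m$-fold covers $\mathcal{H}$ of $G$ ($m \in \mathbb{N}$). $P(G,m)$ is the chromatic polynomial (number of proper colorings of $G$ from $[m]$). The DP color function threshold $\tau_{DP}(G)$ is the smallest $N \geq \chi(G)$ such that $P_{DP}(G,m)=P(G,m)$ for all $m \geq N$, and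 $\tau_{DP}(G)=\infty$ if $P(G,m)-P_{DP}(G,m)>0$ for infinitely many $m$. *)

theory Defs
  imports "Graph_Theory.Graph_Theory" "HOL-Library.Extended_Nat"
    "HOL-Library.Disjoint_Sets" "HOL-Library.FuncSet"
begin

text \<open>
  A finite simple graph is a \<open>pair_graph\<close>: a finite loop-free digraph with symmetric arc
  relation, so that an edge \<open>uv\<close> is present as the two arcs \<open>(u, v)\<close> and \<open>(v, u)\<close>.
\<close>

definition complete_graph :: "nat \<Rightarrow> nat pair_pre_digraph" where
  "complete_graph p = \<lparr>pverts = {..<p}, parcs = {(i, j). i < p \<and> j < p \<and> i \<noteq> j}\<rparr>"

text \<open>The sum type makes the two vertex sets disjoint.\<close>

definition graph_join ::
  "'a pair_pre_digraph \<Rightarrow> 'b pair_pre_digraph \<Rightarrow> ('a + 'b) pair_pre_digraph" where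
  "graph_join G H = \<lparr>pverts = pverts G <+> pverts H,
     parcs = map_prod Inl Inl ` parcs G \<union> map_prod Inr Inr ` parcs H \<union>
             (Inl ` pverts G) \<times> (Inr ` pverts H) \<union> (Inr ` pverts H) \<times> (Inl ` pverts G)\<rparr>"

definition proper_colorings :: "'a pair_pre_digraph \<Rightarrow> nat \<Rightarrow> ('a \<Rightarrow> nat) set" where
  "proper_colorings G m =
     {c \<in> pverts G \<rightarrow>\<^sub>E {1..m}. \<forall>(u, v) \<in> parcs G. c u \<noteq> c v}"

definition chromatic_polynomial :: "'a pair_pre_digraph \<Rightarrow> nat \<Rightarrow> nat" where
  "chromatic_polynomial G m = card (proper_colorings G m)"

definition chromatic_number :: "'a pair_pre_digraph \<Rightarrow> nat" where
  "chromatic_number G = (LEAST k. proper_colorings G k \<noteq> {})"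

text \<open>For disjoint \<open>A\<close> and \<open>B\<close> every edge between them is represented exactly once.\<close>

definition edges_between :: "'b pair_pre_digraph \<Rightarrow> 'b set \<Rightarrow> 'b set \<Rightarrow> ('b \<times> 'b) set" where
  "edges_between H A B = parcs H \<inter> A \<times> B"

definition is_matching :: "('b \<times> 'b) set \<Rightarrow> bool" where
  "is_matching M \<longleftrightarrow>
     (\<forall>e\<in>M. \<forall>e'\<in>M. e \<noteq> e' \<longrightarrow> {fst e, snd e} \<inter> {fst e', snd e'} = {})"

text \<open>
  The partition of the vertices of \<open>H\<close> is the family \<open>L u\<close> indexed by the vertices of \<open>G\<close>;
  empty parts are tolerated, so that \<open>0\<close>-fold covers exist as well. For \<open>m > 0\<close> the parts of
  an \<open>m\<close>-fold cover form a partition into \<open>card (pverts G)\<close> nonempty parts, see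
  \<open>dp_fold_cover_partition\<close> below. Values of \<open>L\<close> outside the vertices of \<open>G\<close> are irrelevant.
\<close>

definition dp_cover ::
  "'a pair_pre_digraph \<Rightarrow> ('a \<Rightarrow> 'b set) \<Rightarrow> 'b pair_pre_digraph \<Rightarrow> bool" where
  "dp_cover G L H \<longleftrightarrow>
     pair_graph H \<and>
     disjoint_family_on L (pverts G) \<and> (\<Union>u\<in>pverts G. L u) = pverts H \<and>
     (\<forall>u\<in>pverts G. \<forall>x\<in>L u. \<forall>y\<in>L u. x \<noteq> y \<longrightarrow> (x, y) \<in> parcs H) \<and>
     (\<forall>u\<in>pverts G. \<forall>v\<in>pverts G.
        u \<noteq> v \<longrightarrow> edges_between H (L u) (L v) \<noteq> {} \<longrightarrow> (u, v) \<in> parcs G) \<and>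
     (\<forall>(u, v)\<in>parcs G. is_matching (edges_between H (L u) (L v)))"

definition dp_fold_cover ::
  "nat \<Rightarrow> 'a pair_pre_digraph \<Rightarrow> ('a \<Rightarrow> 'b set) \<Rightarrow> 'b pair_pre_digraph \<Rightarrow> bool" where
  "dp_fold_cover m G L H \<longleftrightarrow>
     dp_cover G L H \<and> (\<forall>u\<in>pverts G. card (L u) = m)"

definition independent_set :: "'b pair_pre_digraph \<Rightarrow> 'b set \<Rightarrow> bool" where
  "independent_set H I \<longleftrightarrow> I \<subseteq> pverts H \<and> (\<forall>x\<in>I. \<forall>y\<in>I. (x, y) \<notin> parcs H)"

text \<open>The colorings for a cover \<open>(L, H)\<close> of \<open>G\<close> do not depend on \<open>L\<close>.\<close>

definition dp_colorings :: "'a pair_pre_digraph \<Rightarrow> 'b pair_pre_digraph \<Rightarrow> 'b set set" where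
  "dp_colorings G H = {I. independent_set H I \<and> card I = card (pverts G)}"

text \<open>
  Since covers are finite, it suffices to let \<open>H\<close> range over graphs on natural numbers; see
  \<open>dp_color_function_le\<close> and \<open>dp_color_function_attained\<close> below.
\<close>

definition dp_color_function :: "'a pair_pre_digraph \<Rightarrow> nat \<Rightarrow> nat" where
  "dp_color_function G m =
     Inf {card (dp_colorings G H) | (L :: 'a \<Rightarrow> nat set) H. dp_fold_cover m G L H}"

definition dp_threshold :: "'a pair_pre_digraph \<Rightarrow> enat" where
  "dp_threshold G =
     (if infinite {m. chromatic_polynomial G m > dp_color_function G m} then \<infinity>
      else enat (LEAST N. N \<ge> chromatic_number G \<and>
                   (\<forall>m\<ge>N. dp_color_function G m = chromatic_polynomial G m)))"

lemma pair_graphI: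
  assumes "finite V" "E \<subseteq> V \<times> V" "sym E" "\<And>x. (x, x) \<notin> E"
  shows "pair_graph \<lparr>pverts = V, parcs = E\<rparr>"
proof -
  have "finite E" using assms(1,2) finite_subset by blast
  with assms show ?thesis
    by unfold_locales (auto simp: symmetric_def)
qed

lemma pair_graphD:
  assumes "pair_graph G"
  shows "finite (pverts G)" "parcs G \<subseteq> pverts G \<times> pverts G" "sym (parcs G)"
    "\<And>x. (x, x) \<notin> parcs G"
proof -
  interpret pair_graph G by fact
  show "finite (pverts G)" by (rule pair_finite_verts)
  show "parcs G \<subseteq> pverts G \<times> pverts G" using in_arcsD1 in_arcsD2 by auto
  show "sym (parcs G)" using pair_sym_arcs by (simp add: symmetric_def)
  show "(x, x) \<notin> parcs G" for x using pair_no_loops[of "(x, x)"] by auto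
qed

lemma complete_graph_complete: "K\<^bsub>p\<^esub> (with_proj (complete_graph p))"
proof -
  have "pair_graph (complete_graph p)"
    unfolding complete_graph_def by (rule pair_graphI) (auto simp: sym_def)
  then interpret pair_graph "complete_graph p" .
  have "graph (with_proj (complete_graph p))" by unfold_locales
  then show ?thesis
    unfolding complete_digraph_def by (auto simp: complete_graph_def)
qed

lemma pair_graph_join:
  assumes "pair_graph G" "pair_graph H"
  shows "pair_graph (graph_join G H)"
  unfolding graph_join_def
proof (rule pair_graphI)
  note G = pair_graphD[OF assms(1)] and H = pair_graphD[OF assms(2)]
  show "finite (pverts G <+> pverts H)" using G(1) H(1) by simp
  let ?E = "map_prod Inl Inl ` parcs G \<union> map_prod Inr Inr ` parcs H \<union>
    (Inl ` pverts G) \<times> (Inr ` pverts H) \<union> (Inr ` pverts H) \<times> (Inl ` pverts G)"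
  show "?E \<subseteq> (pverts G <+> pverts H) \<times> (pverts G <+> pverts H)"
    using G(2) H(2) by auto
  show "sym ?E" using G(3) H(3) unfolding sym_def by force
  show "(x, x) \<notin> ?E" for x using G(4) H(4) by auto
qed

lemma dp_fold_cover_partition:
  assumes "dp_fold_cover m G L H" "m > 0"
  shows "partition_on (pverts H) (L ` pverts G)" "card (L ` pverts G) = card (pverts G)"
proof -
  have d: "disjoint_family_on L (pverts G)" and U: "(\<Union>u\<in>pverts G. L u) = pverts H"
    and ne: "\<And>u. u \<in> pverts G \<Longrightarrow> L u \<noteq> {}"
    using assms by (auto simp: dp_fold_cover_def dp_cover_def)
  show "partition_on (pverts H) (L ` pverts G)"
    unfolding partition_on_def using U ne disjoint_family_on_disjoint_image[OF d] by auto
  have "inj_on L (pverts G)"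
    using d ne unfolding inj_on_def disjoint_family_on_def by (metis Int_absorb)
  then show "card (L ` pverts G) = card (pverts G)" by (rule card_image)
qed

lemma dp_fold_cover_transfer:
  fixes L :: "'a \<Rightarrow> 'b set"
  assumes G: "pair_graph G" and c: "dp_fold_cover m G L H"
  shows "\<exists>(L' :: 'a \<Rightarrow> nat set) H'. dp_fold_cover m G L' H' \<and>
           card (dp_colorings G H') = card (dp_colorings G H)"
proof -
  have H: "pair_graph H"
    and d: "disjoint_family_on L (pverts G)" and U: "(\<Union>u\<in>pverts G. L u) = pverts H"
    and c2: "\<And>u x y. u \<in> pverts G \<Longrightarrow> x \<in> L u \<Longrightarrow> y \<in> L u \<Longrightarrow> x \<noteq> y \<Longrightarrow> (x, y) \<in> parcs H"
    and c3: "\<And>u v. u \<in> pverts G \<Longrightarrow> v \<in> pverts G \<Longrightarrow> u \<noteq> v \<Longrightarrow>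
               edges_between H (L u) (L v) \<noteq> {} \<Longrightarrow> (u, v) \<in> parcs G"
    and c4: "\<And>u v. (u, v) \<in> parcs G \<Longrightarrow> is_matching (edges_between H (L u) (L v))"
    and m: "\<And>u. u \<in> pverts G \<Longrightarrow> card (L u) = m"
    using c by (auto simp: dp_fold_cover_def dp_cover_def)
  note Gg = pair_graphD[OF G] and Hg = pair_graphD[OF H]
  obtain f :: "'b \<Rightarrow> nat" where f: "inj_on f (pverts H)"
    using finite_imp_inj_to_nat_seg[OF Hg(1)] by auto
  define H' where "H' = \<lparr>pverts = f ` pverts H, parcs = map_prod f f ` parcs H\<rparr>"
  define L' where "L' = (\<lambda>u. f ` L u)"
  have V': "pverts H' = f ` pverts H" by (simp add: H'_def)
  have Lsub: "L u \<subseteq> pverts H" if "u \<in> pverts G" for u using U that by auto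
  have arc: "(f x, f y) \<in> parcs H' \<longleftrightarrow> (x, y) \<in> parcs H"
    if "x \<in> pverts H" "y \<in> pverts H" for x y
  proof
    assume "(f x, f y) \<in> parcs H'"
    then obtain a b where ab: "(a, b) \<in> parcs H" "f a = f x" "f b = f y"
      by (auto simp: H'_def)
    then have "a = x" "b = y" using inj_onD[OF f] Hg(2) that by blast+
    then show "(x, y) \<in> parcs H" using ab by simp
  qed (auto simp: H'_def)
  have H': "pair_graph H'"
    unfolding H'_def
  proof (rule pair_graphI)
    show "finite (f ` pverts H)" using Hg(1) by simp
    show "map_prod f f ` parcs H \<subseteq> f ` pverts H \<times> f ` pverts H" using Hg(2) by auto
    show "sym (map_prod f f ` parcs H)" using Hg(3) unfolding sym_def by force
    show "(x, x) \<notin> map_prod f f ` parcs H" for x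
    proof
      assume "(x, x) \<in> map_prod f f ` parcs H"
      then obtain a b where ab: "(a, b) \<in> parcs H" "f a = f b" by auto
      then have "a = b" using inj_onD[OF f] Hg(2) by blast
      then show False using ab Hg(4) by simp
    qed
  qed
  have eb: "edges_between H' (L' u) (L' v) = map_prod f f ` edges_between H (L u) (L v)"
    if uv: "u \<in> pverts G" "v \<in> pverts G" for u v
  proof
    show "edges_between H' (L' u) (L' v) \<subseteq> map_prod f f ` edges_between H (L u) (L v)"
    proof
      fix e assume e: "e \<in> edges_between H' (L' u) (L' v)"
      then obtain x y where xy: "e = (f x, f y)" "x \<in> L u" "y \<in> L v" "e \<in> parcs H'"
        by (auto simp: edges_between_def L'_def)
      then have "(x, y) \<in> parcs H" using arc Lsub uv by blast
      then show "e \<in> map_prod f f ` edges_between H (L u) (L v)"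
        using xy by (auto simp: edges_between_def)
    qed
    show "map_prod f f ` edges_between H (L u) (L v) \<subseteq> edges_between H' (L' u) (L' v)"
      by (auto simp: edges_between_def L'_def H'_def)
  qed
  have mt: "is_matching (map_prod f f ` M)" if "is_matching M" "M \<subseteq> parcs H" for M
    unfolding is_matching_def
  proof (intro ballI impI)
    fix e e' assume "e \<in> map_prod f f ` M" "e' \<in> map_prod f f ` M" "e \<noteq> e'"
    then obtain a b where ab: "a \<in> M" "e = map_prod f f a" "b \<in> M" "e' = map_prod f f b" "a \<noteq> b"
      by (metis imageE)
    then have "{fst a, snd a} \<inter> {fst b, snd b} = {}" using that(1) by (simp add: is_matching_def)
    moreover have "{fst a, snd a} \<subseteq> pverts H" "{fst b, snd b} \<subseteq> pverts H"
      using ab that(2) Hg(2) by auto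
    ultimately have "f ` {fst a, snd a} \<inter> f ` {fst b, snd b} = {}"
      using inj_on_image_Int[OF f] by (metis image_empty)
    then show "{fst e, snd e} \<inter> {fst e', snd e'} = {}" using ab by simp
  qed
  have "dp_cover G L' H'"
    unfolding dp_cover_def
  proof (intro conjI)
    show "pair_graph H'" by (rule H')
    show "disjoint_family_on L' (pverts G)"
      unfolding disjoint_family_on_def L'_def
    proof (intro ballI impI)
      fix u v assume uv: "u \<in> pverts G" "v \<in> pverts G" "u \<noteq> v"
      then have "L u \<inter> L v = {}" using d by (simp add: disjoint_family_on_def)
      then show "f ` L u \<inter> f ` L v = {}"
        using inj_on_image_Int[OF f Lsub[OF uv(1)] Lsub[OF uv(2)]] by simp
    qed
    show "(\<Union>u\<in>pverts G. L' u) = pverts H'" 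
      unfolding L'_def V' U[symmetric] by (simp add: image_UN)
    show "\<forall>u\<in>pverts G. \<forall>x\<in>L' u. \<forall>y\<in>L' u. x \<noteq> y \<longrightarrow> (x, y) \<in> parcs H'"
      using c2 by (force simp: L'_def H'_def)
    show "\<forall>u\<in>pverts G. \<forall>v\<in>pverts G. u \<noteq> v \<longrightarrow>
        edges_between H' (L' u) (L' v) \<noteq> {} \<longrightarrow> (u, v) \<in> parcs G"
      using c3 by (simp add: eb)
    have "is_matching (edges_between H' (L' u) (L' v))" if "(u, v) \<in> parcs G" for u v
    proof -
      have "u \<in> pverts G" "v \<in> pverts G" using that Gg(2) by auto
      moreover have "edges_between H (L u) (L v) \<subseteq> parcs H"
        by (simp add: edges_between_def)
      ultimately show ?thesis using mt[OF c4[OF that]] by (simp add: eb)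
    qed
    then show "\<forall>(u, v)\<in>parcs G. is_matching (edges_between H' (L' u) (L' v))" by blast
  qed
  moreover have "card (L' u) = m" if "u \<in> pverts G" for u
    using m[OF that] card_image[OF inj_on_subset[OF f Lsub[OF that]]] by (simp add: L'_def)
  ultimately have cov: "dp_fold_cover m G L' H'" by (simp add: dp_fold_cover_def)
  have ind: "independent_set H' (f ` I) \<longleftrightarrow> independent_set H I" if "I \<subseteq> pverts H" for I
    using that arc unfolding independent_set_def V' by (auto simp: subset_iff)
  have "dp_colorings G H' = (`) f ` dp_colorings G H"
  proof
    show "dp_colorings G H' \<subseteq> (`) f ` dp_colorings G H"
    proof
      fix J assume J: "J \<in> dp_colorings G H'"
      then have "J \<subseteq> f ` pverts H" by (simp add: dp_colorings_def independent_set_def V')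
      then obtain I where I: "I \<subseteq> pverts H" "J = f ` I" by (meson subset_imageE)
      then have "card J = card I" using card_image[OF inj_on_subset[OF f]] by simp
      then have "I \<in> dp_colorings G H" using J I ind by (simp add: dp_colorings_def)
      then show "J \<in> (`) f ` dp_colorings G H" using I by simp
    qed
    show "(`) f ` dp_colorings G H \<subseteq> dp_colorings G H'"
    proof
      fix J assume "J \<in> (`) f ` dp_colorings G H"
      then obtain I where I: "I \<in> dp_colorings G H" "J = f ` I" by auto
      then have "I \<subseteq> pverts H" by (simp add: dp_colorings_def independent_set_def)
      then show "J \<in> dp_colorings G H'"
        using I ind card_image[OF inj_on_subset[OF f]] by (simp add: dp_colorings_def)
    qed
  qed
  moreover have "inj_on ((`) f) (dp_colorings G H)"
    by (rule inj_on_subset[OF inj_on_image_Pow[OF f]])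
       (auto simp: dp_colorings_def independent_set_def)
  ultimately have "card (dp_colorings G H') = card (dp_colorings G H)"
    by (simp add: card_image)
  with cov show ?thesis by blast
qed

lemma dp_color_function_le:
  fixes L :: "'a \<Rightarrow> 'b set"
  assumes "pair_graph G" "dp_fold_cover m G L H"
  shows "dp_color_function G m \<le> card (dp_colorings G H)"
proof -
  obtain L' :: "'a \<Rightarrow> nat set" and H'
    where "dp_fold_cover m G L' H'" "card (dp_colorings G H') = card (dp_colorings G H)"
    using dp_fold_cover_transfer[OF assms] by blast
  then have "card (dp_colorings G H)
      \<in> {card (dp_colorings G H) | (L :: 'a \<Rightarrow> nat set) H. dp_fold_cover m G L H}"
    by force
  then show ?thesis unfolding dp_color_function_def by (intro cInf_lower) auto
qed

lemma dp_fold_cover_exists: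
  fixes G :: "'a pair_pre_digraph"
  assumes "pair_graph G"
  shows "\<exists>(L :: 'a \<Rightarrow> ('a \<times> nat) set) H. dp_fold_cover m G L H"
proof -
  define L :: "'a \<Rightarrow> ('a \<times> nat) set" where "L = (\<lambda>u. {u} \<times> {..<m})"
  define H where "H = \<lparr>pverts = pverts G \<times> {..<m},
    parcs = {((u, i), (v, j)). u = v \<and> u \<in> pverts G \<and> i < m \<and> j < m \<and> i \<noteq> j}\<rparr>"
  have "pair_graph H"
    unfolding H_def using pair_graphD(1)[OF assms]
    by (intro pair_graphI) (auto simp: sym_def)
  moreover have "edges_between H (L u) (L v) = {}" if "u \<noteq> v" for u v
    using that by (auto simp: edges_between_def H_def L_def)
  moreover have "u \<noteq> v" if "(u, v) \<in> parcs G" for u v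
    using that pair_graphD(4)[OF assms] by auto
  ultimately have "dp_cover G L H"
    unfolding dp_cover_def disjoint_family_on_def
    by (auto simp: is_matching_def) (auto simp: L_def H_def)
  then show ?thesis by (auto simp: dp_fold_cover_def L_def)
qed

lemma dp_color_function_attained:
  fixes G :: "'a pair_pre_digraph"
  assumes "pair_graph G"
  shows "\<exists>(L :: 'a \<Rightarrow> nat set) H. dp_fold_cover m G L H \<and>
           dp_color_function G m = card (dp_colorings G H)"
proof -
  obtain L :: "'a \<Rightarrow> nat set" and H where "dp_fold_cover m G L H"
    using dp_fold_cover_exists[OF assms] dp_fold_cover_transfer[OF assms] by blast
  then have "{card (dp_colorings G H) | (L :: 'a \<Rightarrow> nat set) H. dp_fold_cover m G L H} \<noteq> {}"
    by blast
  from Inf_nat_def1[OF this] show ?thesis unfolding dp_color_function_def by auto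
qed

end

theory Submission
  imports Defs
begin

text \<open>
  \<open>K\<^sub>p\<^sub>+\<^sub>1 \<or> G\<close> arises from \<open>F = K\<^sub>p \<or> G\<close> by adding a vertex \<open>w\<close> adjacent to everything. In an
  \<open>s\<close>-fold cover of the larger graph, fix the color \<open>x \<in> L(w)\<close>: every other list loses at most
  one color to the neighbors of \<open>x\<close>, so what remains contains an \<open>(s - 1)\<close>-fold cover of \<open>F\<close>, and
  at least \<open>P\<^sub>D\<^sub>P(F, s - 1)\<close> colorings contain \<open>x\<close>. Summing over \<open>x\<close> gives
  \<open>s P\<^sub>D\<^sub>P(F, s - 1)\<close> as a lower bound, which for \<open>s - 1 \<ge> N\<close> is \<open>s P(F, s - 1)\<close>, the chromatic
  polynomial of the larger graph at \<open>s\<close>.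
\<close>

section \<open>Adding a dominating vertex\<close>

definition add_apex :: "'a \<Rightarrow> 'a pair_pre_digraph \<Rightarrow> 'a pair_pre_digraph" where
  "add_apex w F = \<lparr>pverts = insert w (pverts F),
     parcs = parcs F \<union> {w} \<times> pverts F \<union> pverts F \<times> {w}\<rparr>"

lemma pverts_add_apex [simp]: "pverts (add_apex w F) = insert w (pverts F)"
  by (simp add: add_apex_def)

lemma parcs_add_apex [simp]:
  "parcs (add_apex w F) = parcs F \<union> {w} \<times> pverts F \<union> pverts F \<times> {w}"
  by (simp add: add_apex_def)

lemma pair_graph_add_apex:
  assumes "pair_graph F" "w \<notin> pverts F"
  shows "pair_graph (add_apex w F)"
  unfolding add_apex_def using pair_graphD[OF assms(1)] assms(2)
  by (intro pair_graphI) (auto simp: sym_def)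

lemma pair_graph_complete_graph: "pair_graph (complete_graph p)"
  unfolding complete_graph_def by (rule pair_graphI) (auto simp: sym_def)

text \<open>The new vertex of the larger complete graph is \<open>p\<close>, which sits in the join
  as \<open>Inl p\<close>. Since \<open>add_apex\<close> keeps the vertex type and the vertices are
  initial segments, the two sides agree literally and not only up to isomorphism, so the equation
  can be used for rewriting.\<close>

lemma graph_join_complete_graph_Suc:
  "graph_join (complete_graph (p + 1)) G = add_apex (Inl p) (graph_join (complete_graph p) G)"
proof -
  let ?J = "\<lambda>p. graph_join (complete_graph p) G"
  have V: "pverts (?J (p + 1)) = pverts (add_apex (Inl p) (?J p))"
    by (auto simp: graph_join_def complete_graph_def less_Suc_eq)
  have "(x, y) \<in> parcs (?J (p + 1)) \<longleftrightarrow> (x, y) \<in> parcs (add_apex (Inl p) (?J p))" for x y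
    by (cases x; cases y)
       (auto simp: graph_join_def complete_graph_def less_Suc_eq image_iff)
  then have "parcs (?J (p + 1)) = parcs (add_apex (Inl p) (?J p))"
    by (intro set_eqI) (metis surj_pair)
  with V show ?thesis by (intro pair_pre_digraph.equality) simp_all
qed

section \<open>The chromatic polynomial with an added vertex\<close>

text \<open>Relabelling the palette along a bijection \<open>f\<close> from \<open>C\<close> to an
  initial interval preserves properness. This serves palettes with a gap, such as
  \<open>{1..s} - {a}\<close>.\<close>

lemma card_proper_colorings_from:
  assumes F: "pair_graph F" and C: "finite C"
  shows "card {c \<in> pverts F \<rightarrow>\<^sub>E C. \<forall>(u, v) \<in> parcs F. c u \<noteq> c v} =
    chromatic_polynomial F (card C)"
proof -
  note Fg = pair_graphD[OF F]
  obtain f where f: "bij_betw f C {1..card C}"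
    using C by (metis card_atLeastAtMost diff_Suc_1 finite_atLeastAtMost finite_same_card_bij)
  let ?K = "{c \<in> pverts F \<rightarrow>\<^sub>E C. \<forall>(u, v) \<in> parcs F. c u \<noteq> c v}"
  define g where "g = the_inv_into C f"
  have gC: "g a \<in> C" and fg: "f (g a) = a" if "a \<in> {1..card C}" for a
    using that f bij_betw_the_inv_into[OF f] unfolding g_def
    by (auto simp: f_the_inv_into_f_bij_betw dest: bij_betwE)
  have fC: "f a \<in> {1..card C}" and gf: "g (f a) = a" if "a \<in> C" for a
    using that f bij_betwE[OF f] by (auto simp: g_def bij_betw_def the_inv_into_f_f)
  \<comment> \<open>Both directions are restricted to the vertex set because the composites would
    otherwise fail to be extensional.\<close>
  have "bij_betw (\<lambda>c. restrict (f \<circ> c) (pverts F)) ?K (proper_colorings F (card C))"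
  proof (rule bij_betw_byWitness[where f' = "\<lambda>c. restrict (g \<circ> c) (pverts F)"])
    show "\<forall>c\<in>?K. restrict (g \<circ> restrict (f \<circ> c) (pverts F)) (pverts F) = c"
      using gf by (auto simp: fun_eq_iff PiE_def extensional_def Pi_def)
    show "\<forall>c\<in>proper_colorings F (card C).
        restrict (f \<circ> restrict (g \<circ> c) (pverts F)) (pverts F) = c"
      using fg by (auto simp: proper_colorings_def fun_eq_iff PiE_def extensional_def Pi_def)
    show "(\<lambda>c. restrict (f \<circ> c) (pverts F)) ` ?K \<subseteq> proper_colorings F (card C)"
    proof clarify
      fix c assume c: "c \<in> pverts F \<rightarrow>\<^sub>E C" "\<forall>(u, v)\<in>parcs F. c u \<noteq> c v"
      have V: "u \<in> pverts F" "v \<in> pverts F" if "(u, v) \<in> parcs F" for u v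
        using that Fg(2) by auto
      have ne: "f (c u) \<noteq> f (c v)" if "(u, v) \<in> parcs F" for u v
      proof -
        have "c u \<in> C" "c v \<in> C" "c u \<noteq> c v" using that c V[OF that] by auto
        then show ?thesis using gf by metis
      qed
      have "restrict (f \<circ> c) (pverts F) \<in> pverts F \<rightarrow>\<^sub>E {1..card C}"
        using PiE_mem[OF c(1)] fC by (intro restrict_PiE_iff[THEN iffD2]) (metis comp_apply)
      then show "restrict (f \<circ> c) (pverts F) \<in> proper_colorings F (card C)"
        using ne V by (auto simp: proper_colorings_def)
    qed
    show "(\<lambda>c. restrict (g \<circ> c) (pverts F)) ` proper_colorings F (card C) \<subseteq> ?K"
    proof clarify
      fix c assume "c \<in> proper_colorings F (card C)"
      then have c: "c \<in> pverts F \<rightarrow>\<^sub>E {1..card C}" "\<forall>(u, v)\<in>parcs F. c u \<noteq> c v"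
        by (auto simp: proper_colorings_def)
      have V: "u \<in> pverts F" "v \<in> pverts F" if "(u, v) \<in> parcs F" for u v
        using that Fg(2) by auto
      have ne: "g (c u) \<noteq> g (c v)" if "(u, v) \<in> parcs F" for u v
      proof -
        have "c u \<in> {1..card C}" "c v \<in> {1..card C}" "c u \<noteq> c v" using that c V[OF that] by auto
        then show ?thesis using fg by metis
      qed
      have "restrict (g \<circ> c) (pverts F) \<in> pverts F \<rightarrow>\<^sub>E C"
        using PiE_mem[OF c(1)] gC by (intro restrict_PiE_iff[THEN iffD2]) (metis comp_apply)
      then show "restrict (g \<circ> c) (pverts F) \<in> pverts F \<rightarrow>\<^sub>E C \<and>
          (\<forall>(u, v)\<in>parcs F. restrict (g \<circ> c) (pverts F) u \<noteq> restrict (g \<circ> c) (pverts F) v)"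
        using ne V by auto
    qed
  qed
  then show ?thesis unfolding chromatic_polynomial_def by (rule bij_betw_same_card)
qed

lemma finite_proper_colorings:
  assumes "pair_graph F"
  shows "finite (proper_colorings F m)"
  unfolding proper_colorings_def
  using pair_graphD(1)[OF assms] by (auto intro!: finite_PiE)

text \<open>Once \<open>w\<close> has one of the \<open>s\<close> colors, that color is barred
  everywhere else and \<open>F\<close> is colored from the other \<open>s - 1\<close>. For
  \<open>s = 0\<close> the factor \<open>s\<close> makes both sides vanish, whatever the truncated
  difference gives.\<close>

lemma chromatic_polynomial_add_apex:
  assumes F: "pair_graph F" and w: "w \<notin> pverts F"
  shows "chromatic_polynomial (add_apex w F) s = s * chromatic_polynomial F (s - 1)"
proof -
  note Fg = pair_graphD[OF F]
  have wF: "(w, v) \<notin> parcs F" "(v, w) \<notin> parcs F" for v using Fg(2) w by auto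
  let ?A = "\<lambda>a. {c \<in> proper_colorings (add_apex w F) s. c w = a}"
  let ?B = "\<lambda>a. {c \<in> pverts F \<rightarrow>\<^sub>E ({1..s} - {a}). \<forall>(u, v) \<in> parcs F. c u \<noteq> c v}"
  have fin: "finite (proper_colorings (add_apex w F) s)"
    by (intro finite_proper_colorings pair_graph_add_apex F w)
  have A: "card (?A a) = chromatic_polynomial F (s - 1)" if a: "a \<in> {1..s}" for a
  proof -
    \<comment> \<open>Restriction forgets the color of \<open>w\<close>; as this color is fixed to
      be \<open>a\<close>, the update puts it back.\<close>
    have "bij_betw (\<lambda>c. restrict c (pverts F)) (?A a) (?B a)"
    proof (rule bij_betw_byWitness[where f' = "\<lambda>c. c(w := a)"])
      show "\<forall>c\<in>?A a. (restrict c (pverts F))(w := a) = c"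
      proof
        fix c assume c: "c \<in> ?A a"
        then have "c \<in> extensional (insert w (pverts F))"
          by (auto simp: proper_colorings_def PiE_def)
        then show "(restrict c (pverts F))(w := a) = c"
          using c by (auto simp: fun_eq_iff extensional_def)
      qed
      show "\<forall>c\<in>?B a. restrict (c(w := a)) (pverts F) = c"
        using w by (auto simp: fun_eq_iff PiE_def extensional_def)
      show "(\<lambda>c. restrict c (pverts F)) ` ?A a \<subseteq> ?B a"
        using Fg(2) by (fastforce simp: proper_colorings_def)
      show "(\<lambda>c. c(w := a)) ` ?B a \<subseteq> ?A a"
      proof clarify
        fix c assume c: "c \<in> pverts F \<rightarrow>\<^sub>E {1..s} - {a}" "\<forall>(u, v)\<in>parcs F. c u \<noteq> c v"
        then have "c(w := a) \<in> insert w (pverts F) \<rightarrow>\<^sub>E {1..s}"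
          using a by (intro PiE_I) (auto dest: PiE_mem PiE_arb)
        moreover have "(c(w := a)) u \<noteq> (c(w := a)) v" if "(u, v) \<in> parcs (add_apex w F)" for u v
        proof -
          \<comment> \<open>The palette omits \<open>a\<close>, which settles the arcs at
            \<open>w\<close>; on all other arcs the update at \<open>w\<close> changes
            nothing.\<close>
          have "c z \<noteq> a \<and> z \<noteq> w" if "z \<in> pverts F" for z using c(1) that w by auto
          then show ?thesis using that c(2) wF w by auto
        qed
        ultimately show "c(w := a) \<in> proper_colorings (add_apex w F) s \<and> (c(w := a)) w = a"
          unfolding proper_colorings_def pverts_add_apex
          by (simp del: parcs_add_apex fun_upd_apply add: split_beta) simp
      qed
    qed
    then have "card (?A a) = card (?B a)" by (rule bij_betw_same_card)
    then show ?thesis using card_proper_colorings_from[OF F, of "{1..s} - {a}"] a by simp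
  qed
  have "proper_colorings (add_apex w F) s = (\<Union>a\<in>{1..s}. ?A a)"
    by (auto simp: proper_colorings_def)
  then have "chromatic_polynomial (add_apex w F) s = card (\<Union>a\<in>{1..s}. ?A a)"
    by (simp add: chromatic_polynomial_def)
  also have "\<dots> = (\<Sum>a\<in>{1..s}. card (?A a))"
    using fin by (intro card_UN_disjoint) auto
  also have "\<dots> = s * chromatic_polynomial F (s - 1)" using A by simp
  finally show ?thesis .
qed

section \<open>Upper bound for the DP color function\<close>

text \<open>In the cover that matches equal colors along every edge, each coloring is the graph of a
  proper coloring. The minimum over all covers is at most the count for this one.\<close>

lemma dp_color_function_le_chromatic_polynomial:
  fixes F :: "'a pair_pre_digraph"
  assumes F: "pair_graph F"
  shows "dp_color_function F m \<le> chromatic_polynomial F m"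
proof -
  note Fg = pair_graphD[OF F]
  define L :: "'a \<Rightarrow> ('a \<times> nat) set" where "L = (\<lambda>u. {u} \<times> {1..m})"
  \<comment> \<open>This is the Cartesian product of \<open>F\<close> with the complete graph on
    \<open>{1..m}\<close>.\<close>
  define H where "H = \<lparr>pverts = pverts F \<times> {1..m},
    parcs = {((u, i), (v, j)). u \<in> pverts F \<and> v \<in> pverts F \<and> i \<in> {1..m} \<and> j \<in> {1..m} \<and>
      (u = v \<and> i \<noteq> j \<or> (u, v) \<in> parcs F \<and> i = j)}\<rparr>"
  have "pair_graph H"
    unfolding H_def
  proof (rule pair_graphI)
    show "finite (pverts F \<times> {1..m})" using Fg(1) by simp
  qed (use Fg in \<open>auto simp: sym_def\<close>)
  then have "dp_cover F L H"
    using Fg(4) unfolding dp_cover_def disjoint_family_on_def edges_between_def is_matching_def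
    by (auto simp: L_def H_def)
  then have cov: "dp_fold_cover m F L H" by (auto simp: dp_fold_cover_def L_def)
  have "dp_colorings F H \<subseteq> (\<lambda>c. (\<lambda>u. (u, c u)) ` pverts F) ` proper_colorings F m"
  proof
    fix I assume "I \<in> dp_colorings F H"
    then have sub: "I \<subseteq> pverts F \<times> {1..m}" and card: "card I = card (pverts F)"
      and ind: "\<And>x y. x \<in> I \<Longrightarrow> y \<in> I \<Longrightarrow> (x, y) \<notin> parcs H"
      by (auto simp: dp_colorings_def independent_set_def H_def)
    \<comment> \<open>Each list is a clique, so an independent set meets it at most once.\<close>
    have uniq: "i = j" if "(u, i) \<in> I" "(u, j) \<in> I" for u i j
      using ind[OF that] that sub by (auto simp: H_def)
    then have "inj_on fst I" by (auto simp: inj_on_def)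
    then have "card (fst ` I) = card (pverts F)" using card by (simp add: card_image)
    \<comment> \<open>The size condition on colorings enters here: an injective projection of a set
      with \<open>card (pverts F)\<close> elements into \<open>pverts F\<close> is onto.\<close>
    then have fst: "fst ` I = pverts F" using sub Fg(1) by (intro card_subset_eq) auto
    define c where "c = restrict (\<lambda>u. THE i. (u, i) \<in> I) (pverts F)"
    have c: "c u = i" if "(u, i) \<in> I" for u i
      using that uniq sub by (auto simp: c_def)
    have cI: "(u, c u) \<in> I" if u: "u \<in> pverts F" for u
    proof -
      obtain i where "(u, i) \<in> I" using u fst by force
      then show ?thesis using c by simp
    qed
    have I: "I = (\<lambda>u. (u, c u)) ` pverts F"
      using cI c sub by force
    have "c u \<noteq> c v" if "(u, v) \<in> parcs F" for u v
    proof -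
      have "u \<in> pverts F" "v \<in> pverts F" using that Fg(2) by auto
      moreover from this have "c u \<in> {1..m}" "c v \<in> {1..m}" using cI sub by blast+
      ultimately show ?thesis using ind[OF cI cI, of u v] that by (auto simp: H_def)
    qed
    moreover have "c \<in> pverts F \<rightarrow>\<^sub>E {1..m}"
      using cI sub by (auto simp: c_def)
    ultimately have "c \<in> proper_colorings F m" by (auto simp: proper_colorings_def)
    then show "I \<in> (\<lambda>c. (\<lambda>u. (u, c u)) ` pverts F) ` proper_colorings F m"
      using I by blast
  qed
  then have "card (dp_colorings F H) \<le> chromatic_polynomial F m"
    unfolding chromatic_polynomial_def by (rule surj_card_le[OF finite_proper_colorings[OF F]])
  then show ?thesis using dp_color_function_le[OF F cov] by simp
qed

section \<open>Lower bound for the DP color function\<close>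

lemma is_matching_subset: "is_matching M \<Longrightarrow> M' \<subseteq> M \<Longrightarrow> is_matching M'"
  unfolding is_matching_def by (meson subsetD)

text \<open>Inserting \<open>x\<close> maps the colorings of a trimmed cover of \<open>F\<close>
  injectively to colorings through \<open>x\<close>. Equality may fail, since a list in which
  \<open>x\<close> has no neighbor still loses a color.\<close>

lemma dp_colorings_through_apex_color:
  assumes F: "pair_graph F" and w: "w \<notin> pverts F"
    and cov: "dp_fold_cover s (add_apex w F) L H" and x: "x \<in> L w"
  shows "dp_color_function F (s - 1) \<le> card {I \<in> dp_colorings (add_apex w F) H. x \<in> I}"
proof -
  let ?V = "pverts F"
  note Fg = pair_graphD[OF F]
  have cov': "dp_cover (add_apex w F) L H" and s: "\<And>u. u \<in> insert w ?V \<Longrightarrow> card (L u) = s"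
    using cov by (auto simp: dp_fold_cover_def)
  have H: "pair_graph H" using cov' by (simp add: dp_cover_def)
  have d: "L u \<inter> L v = {}" if "u \<in> insert w ?V" "v \<in> insert w ?V" "u \<noteq> v" for u v
    using cov' that unfolding dp_cover_def disjoint_family_on_def pverts_add_apex by blast
  have U: "L w \<union> (\<Union>u\<in>?V. L u) = pverts H" using cov' by (simp add: dp_cover_def)
  have c2: "(x, y) \<in> parcs H" if "u \<in> ?V" "x \<in> L u" "y \<in> L u" "x \<noteq> y" for u x y
    using cov' that unfolding dp_cover_def by simp
  have c3: "(u, v) \<in> parcs F"
    if "u \<in> ?V" "v \<in> ?V" "u \<noteq> v" "edges_between H (L u) (L v) \<noteq> {}" for u v
  proof -
    have "(u, v) \<in> parcs (add_apex w F)" using cov' that unfolding dp_cover_def by simp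
    then show ?thesis using that(1,2) w by auto
  qed
  have c4: "is_matching (edges_between H (L u) (L v))"
    if "(u, v) \<in> parcs (add_apex w F)" for u v
    using cov' that unfolding dp_cover_def by blast
  note Hg = pair_graphD[OF H]
  \<comment> \<open>The subset has exactly \<open>s - 1\<close> elements, because the cover built
    from these lists has to be \<open>(s - 1)\<close>-fold.\<close>
  have "\<exists>M. M \<subseteq> L u - {y. (x, y) \<in> parcs H} \<and> card M = s - 1" if u: "u \<in> ?V" for u
  proof -
    have fin: "finite (L u)" using U Hg(1) u by (metis UN_I Un_iff finite_subset subsetI)
    \<comment> \<open>The matching condition between \<open>L w\<close> and \<open>L u\<close>
      allows \<open>x\<close> at most one neighbor in \<open>L u\<close>.\<close>
    have m: "is_matching (edges_between H (L w) (L u))" using c4[of w u] u by simp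
    have "y = z" if "y \<in> L u" "z \<in> L u" "(x, y) \<in> parcs H" "(x, z) \<in> parcs H" for y z
    proof -
      have "(x, y) \<in> edges_between H (L w) (L u)" "(x, z) \<in> edges_between H (L w) (L u)"
        using that x by (auto simp: edges_between_def)
      then show ?thesis using m unfolding is_matching_def by fastforce
    qed
    then have "card (L u \<inter> {y. (x, y) \<in> parcs H}) \<le> 1"
      using fin by (simp add: card_le_Suc0_iff_eq)
    then have "s - 1 \<le> card (L u - {y. (x, y) \<in> parcs H})"
      using s[of u] u fin by (simp add: card_Diff_subset_Int)
    then show ?thesis by (meson obtain_subset_with_card_n)
  qed
  then obtain M where "\<And>u. u \<in> ?V \<Longrightarrow> M u \<subseteq> L u - {y. (x, y) \<in> parcs H} \<and> card (M u) = s - 1"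
    by metis
  then have M: "\<And>u. u \<in> ?V \<Longrightarrow> M u \<subseteq> L u"
    "\<And>u y. u \<in> ?V \<Longrightarrow> y \<in> M u \<Longrightarrow> (x, y) \<notin> parcs H" "\<And>u. u \<in> ?V \<Longrightarrow> card (M u) = s - 1"
    by blast+
  let ?W = "\<Union>u\<in>?V. M u"
  \<comment> \<open>The subgraph of \<open>H\<close> induced on the trimmed lists inherits the
    clique, edge and matching conditions.\<close>
  define H' where "H' = \<lparr>pverts = ?W, parcs = parcs H \<inter> ?W \<times> ?W\<rparr>"
  have WH: "?W \<subseteq> pverts H" using M(1) U by blast
  \<comment> \<open>Freshness of \<open>x\<close> makes \<open>insert x\<close> injective on
    colorings and raises their size by exactly one, matching the extra vertex
    \<open>w\<close>.\<close>
  have xW: "x \<notin> ?W" using d[of w] w M(1) x by fastforce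
  have "pair_graph H'"
    unfolding H'_def using finite_subset[OF WH Hg(1)] Hg(3,4)
    by (intro pair_graphI) (auto simp: sym_def)
  have eb: "edges_between H' (M u) (M v) \<subseteq> edges_between H (L u) (L v)"
    if "u \<in> ?V" "v \<in> ?V" for u v
    using M(1) that by (auto simp: edges_between_def H'_def)
  have "dp_cover F M H'"
    unfolding dp_cover_def
  proof (intro conjI)
    show "pair_graph H'" by fact
    show "disjoint_family_on M ?V"
      using d M(1) unfolding disjoint_family_on_def by blast
    show "(\<Union>u\<in>?V. M u) = pverts H'" by (simp add: H'_def)
    show "\<forall>u\<in>?V. \<forall>x\<in>M u. \<forall>y\<in>M u. x \<noteq> y \<longrightarrow> (x, y) \<in> parcs H'"
      using c2 M(1) unfolding H'_def by simp blast
    show "\<forall>u\<in>?V. \<forall>v\<in>?V. u \<noteq> v \<longrightarrow> edges_between H' (M u) (M v) \<noteq> {} \<longrightarrow> (u, v) \<in> parcs F"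
      using c3 eb by blast
    show "\<forall>(u, v)\<in>parcs F. is_matching (edges_between H' (M u) (M v))"
    proof clarify
      fix u v assume uv: "(u, v) \<in> parcs F"
      then have "u \<in> ?V" "v \<in> ?V" using Fg(2) by auto
      then show "is_matching (edges_between H' (M u) (M v))"
        using c4[of u v] uv eb[of u v] by (auto intro: is_matching_subset)
    qed
  qed
  then have "dp_fold_cover (s - 1) F M H'" using M(3) by (simp add: dp_fold_cover_def)
  from dp_color_function_le[OF F this]
  have "dp_color_function F (s - 1) \<le> card (dp_colorings F H')" .
  also have "\<dots> = card (insert x ` dp_colorings F H')"
  proof (rule card_image[symmetric], rule inj_onI)
    fix I J assume "I \<in> dp_colorings F H'" "J \<in> dp_colorings F H'" and eq: "insert x I = insert x J"
    then have "x \<notin> I" "x \<notin> J"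
      using xW by (auto simp: dp_colorings_def independent_set_def H'_def)
    then show "I = J" using eq by (metis insert_ident)
  qed
  also have "\<dots> \<le> card {I \<in> dp_colorings (add_apex w F) H. x \<in> I}"
  proof (rule card_mono)
    have "{I \<in> dp_colorings (add_apex w F) H. x \<in> I} \<subseteq> Pow (pverts H)"
      by (auto simp: dp_colorings_def independent_set_def)
    then show "finite {I \<in> dp_colorings (add_apex w F) H. x \<in> I}"
      using Hg(1) by (meson finite_Pow_iff finite_subset)
    show "insert x ` dp_colorings F H' \<subseteq> {I \<in> dp_colorings (add_apex w F) H. x \<in> I}"
    proof clarify
      fix I assume I: "I \<in> dp_colorings F H'"
      then have IW: "I \<subseteq> ?W" and card: "card I = card ?V"
        by (auto simp: dp_colorings_def independent_set_def H'_def)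
      have ind: "(y, z) \<notin> parcs H" if "y \<in> I" "z \<in> I" for y z
        using I IW that unfolding dp_colorings_def independent_set_def H'_def
        by (simp add: subset_iff) blast
      have nb: "(x, y) \<notin> parcs H" "(y, x) \<notin> parcs H" if "y \<in> I" for y
        using M(2) IW that symD[OF Hg(3)] by blast+
      have "x \<notin> I" "finite I" using xW IW finite_subset[OF WH Hg(1)] finite_subset by auto
      then have "card (insert x I) = card (insert w ?V)" using card w Fg(1) by simp
      moreover have "insert x I \<subseteq> pverts H" using IW WH x U by auto
      ultimately show "insert x I \<in> dp_colorings (add_apex w F) H \<and> x \<in> insert x I"
        using nb ind Hg(4) by (auto simp: dp_colorings_def independent_set_def)
    qed
  qed
  finally show ?thesis .
qed

text \<open>In a cover attaining the minimum, \<open>L w\<close> is a clique, so no coloring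
  contains two of its colors. The bounds for the \<open>s\<close> colors \<open>x\<close> therefore
  add up without double counting.\<close>

lemma dp_color_function_add_apex_ge:
  assumes F: "pair_graph F" and w: "w \<notin> pverts F"
  shows "s * dp_color_function F (s - 1) \<le> dp_color_function (add_apex w F) s"
proof -
  obtain L :: "'a \<Rightarrow> nat set" and H where cov: "dp_fold_cover s (add_apex w F) L H"
    and P: "dp_color_function (add_apex w F) s = card (dp_colorings (add_apex w F) H)"
    using dp_color_function_attained[OF pair_graph_add_apex[OF F w]] by blast
  let ?D = "dp_colorings (add_apex w F) H"
  have H: "pair_graph H" and c: "\<And>x y. x \<in> L w \<Longrightarrow> y \<in> L w \<Longrightarrow> x \<noteq> y \<Longrightarrow> (x, y) \<in> parcs H"
    and s: "card (L w) = s" and sub: "L w \<subseteq> pverts H"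
    using cov by (auto simp: dp_fold_cover_def dp_cover_def)
  note Hg = pair_graphD[OF H]
  have "?D \<subseteq> Pow (pverts H)" by (auto simp: dp_colorings_def independent_set_def)
  then have fin: "finite ?D" using Hg(1) by (meson finite_Pow_iff finite_subset)
  have "s * dp_color_function F (s - 1) = (\<Sum>x\<in>L w. dp_color_function F (s - 1))"
    using s by simp
  also have "\<dots> \<le> (\<Sum>x\<in>L w. card {I \<in> ?D. x \<in> I})"
    using dp_colorings_through_apex_color[OF F w cov] by (rule sum_mono)
  also have "\<dots> = card (\<Union>x\<in>L w. {I \<in> ?D. x \<in> I})"
  proof (rule card_UN_disjoint[symmetric])
    show "finite (L w)" using sub Hg(1) by (rule finite_subset)
    show "\<forall>x\<in>L w. \<forall>y\<in>L w. x \<noteq> y \<longrightarrow> {I \<in> ?D. x \<in> I} \<inter> {I \<in> ?D. y \<in> I} = {}"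
      using c unfolding dp_colorings_def independent_set_def by blast
  qed (use fin in auto)
  also have "\<dots> \<le> card ?D" using fin by (intro card_mono) auto
  finally show ?thesis using P by simp
qed

text \<open>Squeeze: the lower bound \<open>s * dp_color_function F (s - 1)\<close> becomes the
  chromatic polynomial of the larger graph, which is also an upper bound. Agreement for
  \<open>F\<close> enters at the single value \<open>s - 1\<close>.\<close>

lemma dp_color_function_add_apex_eq:
  assumes F: "pair_graph F" and w: "w \<notin> pverts F"
    and eq: "dp_color_function F (s - 1) = chromatic_polynomial F (s - 1)"
  shows "dp_color_function (add_apex w F) s = chromatic_polynomial (add_apex w F) s"
  using dp_color_function_add_apex_ge[OF F w, of s] eq chromatic_polynomial_add_apex[OF F w, of s]
    dp_color_function_le_chromatic_polynomial[OF pair_graph_add_apex[OF F w], of s]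
  by simp

section \<open>Chromatic number and threshold\<close>

text \<open>Giving all vertices different colors is proper because there are no loops; hence the
  \<open>LEAST\<close> in the definition is attained.\<close>

lemma proper_colorings_chromatic_number:
  assumes F: "pair_graph F"
  shows "proper_colorings F (chromatic_number F) \<noteq> {}"
proof -
  note Fg = pair_graphD[OF F]
  obtain f :: "'a \<Rightarrow> nat" where f: "bij_betw f (pverts F) {1..card (pverts F)}"
    using Fg(1) by (metis card_atLeastAtMost diff_Suc_1 finite_atLeastAtMost finite_same_card_bij)
  have "f u \<noteq> f v" if "(u, v) \<in> parcs F" for u v
  proof -
    have "u \<in> pverts F" "v \<in> pverts F" "u \<noteq> v" using that Fg(2,4) by auto
    then show ?thesis using f by (metis bij_betw_def inj_on_def)
  qed
  then have "restrict f (pverts F) \<in> proper_colorings F (card (pverts F))"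
    using bij_betwE[OF f] Fg(2) by (auto simp: proper_colorings_def)
  then have "\<exists>k. proper_colorings F k \<noteq> {}" by blast
  then show ?thesis unfolding chromatic_number_def by (rule LeastI_ex)
qed

text \<open>The product formula is positive at \<open>chromatic_number F + 1\<close>, where its
  second factor counts the colorings of \<open>F\<close> with \<open>chromatic_number F\<close>
  colors.\<close>

lemma chromatic_number_add_apex_le:
  assumes F: "pair_graph F" and w: "w \<notin> pverts F"
  shows "chromatic_number (add_apex w F) \<le> chromatic_number F + 1"
proof -
  have "chromatic_polynomial F (chromatic_number F) > 0"
    using proper_colorings_chromatic_number[OF F] finite_proper_colorings[OF F]
    by (simp add: chromatic_polynomial_def card_gt_0_iff)
  then have "chromatic_polynomial (add_apex w F) (chromatic_number F + 1) > 0"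
    using chromatic_polynomial_add_apex[OF F w, of "chromatic_number F + 1"] by simp
  then have "proper_colorings (add_apex w F) (chromatic_number F + 1) \<noteq> {}"
    by (auto simp: chromatic_polynomial_def)
  then show ?thesis unfolding chromatic_number_def[of "add_apex w F"] by (rule Least_le)
qed

text \<open>All values of strict inequality lie below \<open>N\<close>, which rules out the infinite
  case; \<open>N\<close> is then a candidate for the minimum.\<close>

lemma dp_threshold_le:
  assumes "chromatic_number F \<le> N"
    and eq: "\<And>m. m \<ge> N \<Longrightarrow> dp_color_function F m = chromatic_polynomial F m"
  shows "dp_threshold F \<le> enat N"
proof -
  have "{m. chromatic_polynomial F m > dp_color_function F m} \<subseteq> {..<N}"
    using eq by (metis (mono_tags) less_irrefl lessThan_iff mem_Collect_eq not_le subsetI)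
  then have "finite {m. chromatic_polynomial F m > dp_color_function F m}"
    using finite_subset by blast
  then show ?thesis unfolding dp_threshold_def using assms by (auto intro!: Least_le)
qed

text \<open>Finiteness only says that strict inequality stops beyond some \<open>B\<close>. Together
  with the upper bound by the chromatic polynomial this gives equality from \<open>B\<close> on, so
  the \<open>LEAST\<close> is attained and has the defining properties.\<close>

lemma dp_threshold_finiteE:
  assumes F: "pair_graph F" and "dp_threshold F \<noteq> \<infinity>"
  obtains N where "dp_threshold F = enat N" "chromatic_number F \<le> N"
    "\<And>m. m \<ge> N \<Longrightarrow> dp_color_function F m = chromatic_polynomial F m"
proof -
  let ?Q = "\<lambda>N. chromatic_number F \<le> N \<and>
    (\<forall>m\<ge>N. dp_color_function F m = chromatic_polynomial F m)"
  have fin: "finite {m. chromatic_polynomial F m > dp_color_function F m}"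
    using assms(2) by (auto simp: dp_threshold_def split: if_splits)
  then obtain B where B: "\<And>m. chromatic_polynomial F m > dp_color_function F m \<Longrightarrow> m < B"
    unfolding finite_nat_set_iff_bounded by blast
  have "dp_color_function F m = chromatic_polynomial F m" if "m \<ge> B" for m
    using B[of m] that dp_color_function_le_chromatic_polynomial[OF F, of m] by linarith
  \<comment> \<open>The maximum meets the requirement on the chromatic number as well.\<close>
  then have "?Q (max B (chromatic_number F))" by auto
  then have "?Q (LEAST N. ?Q N)" by (rule LeastI)
  moreover have "dp_threshold F = enat (LEAST N. ?Q N)"
    using fin by (simp add: dp_threshold_def)
  ultimately show ?thesis using that by blast
qed

text \<open>An infinite threshold makes the bound trivial. A finite one moves up by one in both
  conditions: the chromatic number grows by at most one, and agreement at \<open>m - 1\<close>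
  passes to \<open>m\<close>.\<close>

lemma dp_threshold_add_apex_le:
  assumes F: "pair_graph F" and w: "w \<notin> pverts F"
  shows "dp_threshold (add_apex w F) \<le> dp_threshold F + 1"
proof (cases "dp_threshold F = \<infinity>")
  case False
  with F obtain N where N: "dp_threshold F = enat N" "chromatic_number F \<le> N"
    "\<And>m. m \<ge> N \<Longrightarrow> dp_color_function F m = chromatic_polynomial F m"
    by (rule dp_threshold_finiteE) blast
  have "dp_threshold (add_apex w F) \<le> enat (N + 1)"
  proof (rule dp_threshold_le)
    show "chromatic_number (add_apex w F) \<le> N + 1"
      using chromatic_number_add_apex_le[OF F w] N(2) by simp
    show "dp_color_function (add_apex w F) m = chromatic_polynomial (add_apex w F) m"
      if "m \<ge> N + 1" for m
      using that by (intro dp_color_function_add_apex_eq F w N(3)) simp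
  qed
  then show ?thesis using N(1) by (simp add: one_enat_def)
qed simp

theorem theorem1p7:
  fixes G :: "'a pair_pre_digraph" and p :: nat
  assumes "pair_graph G"
  shows "(\<forall>N::nat.
            (\<forall>m\<ge>N. dp_color_function (graph_join (complete_graph p) G) m =
                     chromatic_polynomial (graph_join (complete_graph p) G) m) \<longrightarrow>
            (\<forall>s\<ge>N+1. dp_color_function (graph_join (complete_graph (p+1)) G) s =
                       chromatic_polynomial (graph_join (complete_graph (p+1)) G) s)) \<and>
         dp_threshold (graph_join (complete_graph (p+1)) G) \<le>
           dp_threshold (graph_join (complete_graph p) G) + 1"
proof -
  let ?F = "graph_join (complete_graph p) G"
  have F: "pair_graph ?F" by (intro pair_graph_join pair_graph_complete_graph assms)
  have w: "Inl p \<notin> pverts ?F" by (auto simp: graph_join_def complete_graph_def)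
  \<comment> \<open>After rewriting, both claims concern \<open>add_apex (Inl p)\<close>; for the
    first, \<open>s \<ge> N + 1\<close> gives \<open>s - 1 \<ge> N\<close>.\<close>
  show ?thesis
    unfolding graph_join_complete_graph_Suc
    using dp_color_function_add_apex_eq[OF F w] dp_threshold_add_apex_le[OF F w] by simp
qed

end
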